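(* Consider 8-move peg solitaire on any one of the following four boards: the standard 33-hole board, the 37-hole board, $Diamond(4)$, or $Diamond(5)$. Then for every pair of holes $a,b$ of the board (possibly $a=b$), starting from the position in which every hole is occupied by a peg except $a$, there is a sequence of legal jumps ending in a position with exactly one peg, located at $b$.
   Context: Boards are finite sets of lattice points (holes), each hole either empty or holding one peg. Using coordinates (column $x$, row $y$) with integers: the standard 33-hole board consists of the $(x,y)$ with $1\le x,y\le 7$ and ($3\le x\le 5$ or $3\le y\le 5$); the 37-hole board consists of the $(x,y)$ with $1\le x,y\le 7$ and $|x-4|+|y-4|\le 4$ and additionally excluding nothing else, i.e. rows 1 and 7 contain columns 3–5, rows 2 and 6 contain columns 2–6, and rows 3–5 contain columns 1–7; $Diamond(n)$ consists of the $(x,y)$ with $|x-n|+|y-n|\le n-1$ (so it has $n^2+(n-1)^2$ holes). In 8-move solitaire a jump takes a peg at hole $p$, with the hole $p+v$ occupied and $p+2v$ empty, where $v\in\{(\pm1,0),(0,\pm1),(\pm1,\pm1)\}$ and all three holes are on the board; the peg moves to $p+2v$ and the peg at $p+v$ is removed. *)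

theory Defs
  imports Main
begin

(* Holes are pairs (column, row). *)
type_synonym hole = "int \<times> int"

(* A position is the set of occupied holes. *)
type_synonym position = "hole set"

definition board33 :: "hole set" where
  "board33 = {(x, y). 1 \<le> x \<and> x \<le> 7 \<and> 1 \<le> y \<and> y \<le> 7 \<and>
                      (3 \<le> x \<and> x \<le> 5 \<or> 3 \<le> y \<and> y \<le> 5)}"

definition board37 :: "hole set" where
  "board37 = {(x, y). 1 \<le> x \<and> x \<le> 7 \<and> 1 \<le> y \<and> y \<le> 7 \<and> \<bar>x - 4\<bar> + \<bar>y - 4\<bar> \<le> 4}"

definition Diamond :: "nat \<Rightarrow> hole set" where
  "Diamond n = {(x, y). \<bar>x - int n\<bar> + \<bar>y - int n\<bar> \<le> int n - 1}"

definition directions8 :: "(int \<times> int) set" where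
  "directions8 = {(1, 0), (-1, 0), (0, 1), (0, -1), (1, 1), (1, -1), (-1, 1), (-1, -1)}"

inductive jump8 :: "hole set \<Rightarrow> position \<Rightarrow> position \<Rightarrow> bool" for B :: "hole set" where
  "\<lbrakk>(u, v) \<in> directions8;
    (x, y) \<in> B; (x + u, y + v) \<in> B; (x + 2 * u, y + 2 * v) \<in> B;
    (x, y) \<in> P; (x + u, y + v) \<in> P; (x + 2 * u, y + 2 * v) \<notin> P\<rbrakk>
   \<Longrightarrow> jump8 B P (insert (x + 2 * u, y + 2 * v) (P - {(x, y), (x + u, y + v)}))"

end

theory Submission
  imports Defs
begin

text \<open>
  A jump carries \<^term>\<open>P\<close> to \<^term>\<open>Q\<close> exactly if the same jump carries \<^term>\<open>B - Q\<close> to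
  \<^term>\<open>B - P\<close>. Hence, if a position \<^term>\<open>R\<close> can be played down to a single peg at each
  hole of the board, then each single vacancy can be played to \<^term>\<open>B - R\<close>. Given in addition
  a bridge from \<^term>\<open>B - R\<close> to a position \<^term>\<open>R'\<close> that can also be played down to every
  hole, all pairs of holes are solved at once. With \<^term>\<open>R\<close> and \<^term>\<open>R'\<close> symmetric, only
  one solution per symmetry class of final holes has to be exhibited. On the 37-hole board and on
  \<open>Diamond(5)\<close> the central 3 by 3 block serves as both \<^term>\<open>R\<close> and \<^term>\<open>R'\<close>. On the
  33-hole board, \<^term>\<open>R = R'\<close> is a position of nine pegs symmetric in a diagonal, and on
  \<open>Diamond(4)\<close>, \<^term>\<open>R\<close> is a triangle of nine pegs and \<^term>\<open>R'\<close> is its image under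
  a half turn. The positions and jump sequences were found by computer search.
\<close>

section \<open>Reversal and symmetries of jumps\<close>

lemma direction_nonzero: "(u, v) \<in> directions8 \<Longrightarrow> u \<noteq> 0 \<or> v \<noteq> 0"
  by (auto simp: directions8_def)

text \<open>A jump turns the pattern full, full, empty into empty, empty, full. Complementing the
  latter gives full, full, empty on the same three holes, so the same jump, with unchanged start and
  direction, undoes the exchange in the complement.\<close>

lemma jump8_complement:
  assumes "jump8 B P Q" and "P \<subseteq> B"
  shows "jump8 B (B - Q) (B - P)" and "Q \<subseteq> B"
proof -
  from assms(1) obtain u v x y where d: "(u, v) \<in> directions8"
    and B: "(x, y) \<in> B" "(x + u, y + v) \<in> B" "(x + 2 * u, y + 2 * v) \<in> B"
    and P: "(x, y) \<in> P" "(x + u, y + v) \<in> P" "(x + 2 * u, y + 2 * v) \<notin> P"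
    and Q: "Q = insert (x + 2 * u, y + 2 * v) (P - {(x, y), (x + u, y + v)})"
    by (auto elim: jump8.cases)
  have ne: "(x, y) \<noteq> (x + 2 * u, y + 2 * v)" "(x + u, y + v) \<noteq> (x + 2 * u, y + 2 * v)"
    using direction_nonzero[OF d] by auto
  have "B - P = insert (x + 2 * u, y + 2 * v) ((B - Q) - {(x, y), (x + u, y + v)})"
    using P B ne unfolding Q by blast
  moreover have "jump8 B (B - Q) (insert (x + 2 * u, y + 2 * v) ((B - Q) - {(x, y), (x + u, y + v)}))"
    using d B P ne unfolding Q by (intro jump8.intros) auto
  ultimately show "jump8 B (B - Q) (B - P)" by simp
  show "Q \<subseteq> B" using assms(2) B unfolding Q by blast
qed

lemma jumps_complement:
  assumes "(jump8 B)\<^sup>*\<^sup>* P Q" and "P \<subseteq> B"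
  shows "(jump8 B)\<^sup>*\<^sup>* (B - Q) (B - P)"
proof -
  \<comment> \<open>\<open>Q \<subseteq> B\<close> is carried along because
    \<open>jump8_complement\<close> needs it for the following jump. A jump appended to the original
    run is prepended to the complemented one.\<close>
  have "Q \<subseteq> B \<and> (jump8 B)\<^sup>*\<^sup>* (B - Q) (B - P)"
    using assms
    by (induction rule: rtranclp_induct)
      (use jump8_complement in \<open>blast intro: converse_rtranclp_into_rtranclp\<close>)+
  then show ?thesis ..
qed

text \<open>\<open>d\<close> plays the part of the linear part of the affine map \<open>f\<close>.
  One displacement law with a factor \<open>k\<close> covers both the jumped hole
  (\<open>k = 1\<close>) and the landing hole (\<open>k = 2\<close>).\<close>

definition lattice_symmetry :: "(hole \<Rightarrow> hole) \<Rightarrow> bool" where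
  "lattice_symmetry f \<longleftrightarrow> inj f \<and> (\<exists>d. d ` directions8 \<subseteq> directions8 \<and>
    (\<forall>x y u v k. f (x + k * u, y + k * v) =
      (fst (f (x, y)) + k * fst (d (u, v)), snd (f (x, y)) + k * snd (d (u, v)))))"

lemma lattice_symmetry_swap: "lattice_symmetry prod.swap"
  unfolding lattice_symmetry_def
  by (intro conjI exI[of _ prod.swap]) (auto simp: directions8_def)

lemma lattice_symmetry_reflect: "lattice_symmetry (\<lambda>(x, y). (- x, y))"
  unfolding lattice_symmetry_def
  by (intro conjI exI[of _ "\<lambda>(u, v). (- u, v)"]) (auto simp: directions8_def inj_def)

lemma lattice_symmetry_rotate: "lattice_symmetry (\<lambda>(x, y). (- x, - y))"
  unfolding lattice_symmetry_def
  by (intro conjI exI[of _ "\<lambda>(u, v). (- u, - v)"]) (auto simp: directions8_def inj_def)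

lemma lattice_symmetry_translate: "lattice_symmetry (\<lambda>(x, y). (x + c, y + d))"
  unfolding lattice_symmetry_def
  by (intro conjI exI[of _ id]) (auto simp: inj_def)

text \<open>The displacement law sends the three holes of a jump to the three holes of a jump in the
  direction \<open>D (u, v)\<close>. Injectivity keeps the landing hole empty and lets the image
  commute with the removal of pegs.\<close>

lemma jump8_image:
  assumes f: "lattice_symmetry f" and "jump8 B P Q"
  shows "jump8 (f ` B) (f ` P) (f ` Q)"
proof -
  from assms(2) obtain u v x y where d: "(u, v) \<in> directions8"
    and B: "(x, y) \<in> B" "(x + u, y + v) \<in> B" "(x + 2 * u, y + 2 * v) \<in> B"
    and P: "(x, y) \<in> P" "(x + u, y + v) \<in> P" "(x + 2 * u, y + 2 * v) \<notin> P"
    and Q: "Q = insert (x + 2 * u, y + 2 * v) (P - {(x, y), (x + u, y + v)})"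
    by (auto elim: jump8.cases)
  have inj: "inj f" using f by (simp add: lattice_symmetry_def)
  from f obtain D where D: "D ` directions8 \<subseteq> directions8"
    and shift: "\<And>x y u v k. f (x + k * u, y + k * v) =
      (fst (f (x, y)) + k * fst (D (u, v)), snd (f (x, y)) + k * snd (D (u, v)))"
    by (auto simp only: lattice_symmetry_def)
  obtain u' v' where D0: "D (u, v) = (u', v')" by (rule prod.exhaust)
  have d': "(u', v') \<in> directions8" using imageI[OF d, of D] D D0 by auto
  obtain x' y' where f0: "f (x, y) = (x', y')" by (rule prod.exhaust)
  have f1: "f (x + u, y + v) = (x' + u', y' + v')"
    and f2: "f (x + 2 * u, y + 2 * v) = (x' + 2 * u', y' + 2 * v')"
    using shift[of x 1 u y v] shift[of x 2 u y v] f0 D0 by simp_all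
  have "f ` Q = insert (x' + 2 * u', y' + 2 * v') (f ` P - {(x', y'), (x' + u', y' + v')})"
    unfolding Q by (simp add: image_set_diff[OF inj] f0 f1 f2)
  moreover have "jump8 (f ` B) (f ` P)
      (insert (x' + 2 * u', y' + 2 * v') (f ` P - {(x', y'), (x' + u', y' + v')}))"
  proof (rule jump8.intros[OF d'])
    show "(x', y') \<in> f ` B" "(x' + u', y' + v') \<in> f ` B" "(x' + 2 * u', y' + 2 * v') \<in> f ` B"
      "(x', y') \<in> f ` P" "(x' + u', y' + v') \<in> f ` P" "(x' + 2 * u', y' + 2 * v') \<notin> f ` P"
      using B P by (simp_all add: f0[symmetric] f1[symmetric] f2[symmetric] inj_image_mem_iff[OF inj])
  qed
  ultimately show ?thesis by simp
qed

lemma jumps_image: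
  assumes f: "lattice_symmetry f" and "(jump8 B)\<^sup>*\<^sup>* P Q"
  shows "(jump8 (f ` B))\<^sup>*\<^sup>* (f ` P) (f ` Q)"
  using assms(2)
  by (induction rule: rtranclp_induct)
    (use jump8_image[OF f] in \<open>blast intro: rtranclp.rtrancl_into_rtrancl\<close>)+

section \<open>Solvable boards\<close>

definition solvable :: "hole set \<Rightarrow> bool" where
  "solvable B \<longleftrightarrow> (\<forall>a\<in>B. \<forall>b\<in>B. (jump8 B)\<^sup>*\<^sup>* (B - {a}) {b})"

definition universal :: "hole set \<Rightarrow> position \<Rightarrow> bool" where
  "universal B R \<longleftrightarrow> (\<forall>b\<in>B. (jump8 B)\<^sup>*\<^sup>* R {b})"

lemma solvable_image:
  assumes f: "lattice_symmetry f" and "solvable B"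
  shows "solvable (f ` B)"
proof -
  have inj: "inj f" using f by (simp add: lattice_symmetry_def)
  have "(jump8 (f ` B))\<^sup>*\<^sup>* (f ` B - {f a}) {f b}" if "a \<in> B" "b \<in> B" for a b
    using jumps_image[OF f, of B "B - {a}" "{b}"] assms(2) that
    by (simp add: solvable_def image_set_diff[OF inj])
  then show ?thesis by (auto simp: solvable_def)
qed

lemma universal_image:
  assumes "lattice_symmetry f" and "universal B R"
  shows "universal (f ` B) (f ` R)"
  using jumps_image[OF assms(1), of B R] assms(2) by (fastforce simp: universal_def)

lemma solvable_if_universal:
  assumes "universal B R" and "R \<subseteq> B"
    and "(jump8 B)\<^sup>*\<^sup>* (B - R) R'" and "universal B R'"
  shows "solvable B"
  unfolding solvable_def
proof (intro ballI)
  fix a b assume "a \<in> B" "b \<in> B"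
  \<comment> \<open>This is the complement of the run from \<open>R\<close> to
    \<open>{a}\<close>.\<close>
  have "(jump8 B)\<^sup>*\<^sup>* (B - {a}) (B - R)"
    using assms(1,2) \<open>a \<in> B\<close> by (intro jumps_complement) (auto simp: universal_def)
  also note assms(3)
  also have "(jump8 B)\<^sup>*\<^sup>* R' {b}"
    using assms(4) \<open>b \<in> B\<close> by (simp add: universal_def)
  finally show "(jump8 B)\<^sup>*\<^sup>* (B - {a}) {b}" .
qed

text \<open>Reflecting a run that ends at \<open>(y, x)\<close> in the diagonal gives a run from the
  same \<open>R\<close> that ends at \<open>(x, y)\<close>.\<close>

lemma universal_by_diagonal_symmetry:
  assumes B: "prod.swap ` B = B" and R: "prod.swap ` R = R"
    and half: "\<And>x y. (x, y) \<in> B \<Longrightarrow> x \<le> y \<Longrightarrow> (jump8 B)\<^sup>*\<^sup>* R {(x, y)}"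
  shows "universal B R"
  unfolding universal_def
proof
  fix b assume "b \<in> B"
  obtain x y where b: "b = (x, y)" by fastforce
  show "(jump8 B)\<^sup>*\<^sup>* R {b}"
  proof (cases "x \<le> y")
    case False
    have "(y, x) \<in> B" using B b \<open>b \<in> B\<close> by (metis image_eqI swap_simp)
    then have "(jump8 B)\<^sup>*\<^sup>* R {(y, x)}" using False half by simp
    from jumps_image[OF lattice_symmetry_swap this] show ?thesis
      using B R b by simp
  qed (use half b \<open>b \<in> B\<close> in simp)
qed

text \<open>The two reflections generate the dihedral group of order 8, and the octant
  \<open>0 \<le> x \<le> y\<close> meets each of its orbits. The reachable holes are closed under
  the group, so the proof extends from the octant to the quadrant, the half plane and the whole
  board.\<close>

lemma universal_by_full_symmetry:
  fixes B R :: "hole set"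
  assumes B: "prod.swap ` B = B" "(\<lambda>(x, y). (- x, y)) ` B = B"
    and R: "prod.swap ` R = R" "(\<lambda>(x, y). (- x, y)) ` R = R"
    and octant: "\<And>x y. (x, y) \<in> B \<Longrightarrow> 0 \<le> x \<Longrightarrow> x \<le> y \<Longrightarrow> (jump8 B)\<^sup>*\<^sup>* R {(x, y)}"
  shows "universal B R"
proof -
  define S where "S = {b \<in> B. (jump8 B)\<^sup>*\<^sup>* R {b}}"
  have closed: "f b \<in> S" if "b \<in> S" "lattice_symmetry f" "f ` B = B" "f ` R = R" for f b
    using jumps_image[OF that(2), of B R "{b}"] that(1,3,4) unfolding S_def by auto
  have swap: "(y, x) \<in> S" if "(x, y) \<in> S" for x y
    using closed[OF that lattice_symmetry_swap B(1) R(1)] by simp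
  have neg: "(- x, y) \<in> S" if "(x, y) \<in> S" for x y
    using closed[OF that lattice_symmetry_reflect B(2) R(2)] by simp
  have B_swap: "(y, x) \<in> B" if "(x, y) \<in> B" for x y
    using B(1) that by (metis image_eqI swap_simp)
  have B_neg: "(- x, y) \<in> B" if "(x, y) \<in> B" for x y
    using imageI[OF that, of "\<lambda>(x, y). (- x, y)"] B(2) by simp
  have pos: "(x, y) \<in> S" if "(x, y) \<in> B" "0 \<le> x" "0 \<le> y" for x y
  proof (cases "x \<le> y")
    case True
    then show ?thesis using octant that by (simp add: S_def)
  next
    case False
    then have "(y, x) \<in> S" using octant[OF B_swap] B_swap that by (simp add: S_def)
    then show ?thesis by (rule swap)
  qed
  have right: "(x, y) \<in> S" if "(x, y) \<in> B" "0 \<le> x" for x y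
  proof (cases "0 \<le> y")
    case False
    \<comment> \<open>The reflection in the horizontal axis is the conjugate of
      \<open>(x, y) \<mapsto> (- x, y)\<close> by the swap.\<close>
    have "(x, - y) \<in> B" using B_swap[OF B_neg[OF B_swap[OF that(1)]]] .
    then have "(x, - y) \<in> S" using that False by (intro pos) auto
    then show ?thesis using swap[OF neg[OF swap]] by fastforce
  qed (use pos that in simp)
  have "(x, y) \<in> S" if "(x, y) \<in> B" for x y
  proof (cases "0 \<le> x")
    case False
    then have "(- x, y) \<in> S" using right B_neg[OF that] by simp
    then show ?thesis using neg by fastforce
  qed (use right that in simp)
  then show ?thesis by (auto simp: universal_def S_def)
qed

section \<open>Executable play\<close>

text \<open>The board is a predicate and directions are tested arithmetically, so that concrete
  games can be evaluated. The result is \<open>None\<close> as soon as one jump is illegal.\<close>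

fun play :: "(hole \<Rightarrow> bool) \<Rightarrow> hole list \<Rightarrow> (hole \<times> hole) list \<Rightarrow> hole list option" where
  "play S P [] = Some P"
| "play S P (((x, y), (u, v)) # ms) =
    (let p = (x, y); q = (x + u, y + v); r = (x + 2 * u, y + 2 * v)
     in if S p \<and> S q \<and> S r \<and> \<bar>u\<bar> \<le> 1 \<and> \<bar>v\<bar> \<le> 1 \<and> (u, v) \<noteq> (0, 0) \<and>
           p \<in> set P \<and> q \<in> set P \<and> r \<notin> set P
        then play S (r # filter (\<lambda>h. h \<noteq> p \<and> h \<noteq> q) P) ms
        else None)"

text \<open>Positions are compared as sets because \<open>play\<close> changes the order of the
  list.\<close>

definition leads_to :: "(hole \<Rightarrow> bool) \<Rightarrow> hole list \<Rightarrow> (hole \<times> hole) list \<Rightarrow> hole list \<Rightarrow> bool" where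
  "leads_to S P ms Q \<longleftrightarrow> (case play S P ms of None \<Rightarrow> False
     | Some P' \<Rightarrow> set P' = set Q)"

text \<open>The square is large enough for all four centered boards. The product lists the holes
  lexicographically, which fixes the order of the recorded solutions.\<close>

definition holes :: "(hole \<Rightarrow> bool) \<Rightarrow> hole list" where
  "holes S = filter S (List.product [-4..4] [-4..4])"

lemma directions8_iff: "(u, v) \<in> directions8 \<longleftrightarrow> \<bar>u\<bar> \<le> 1 \<and> \<bar>v\<bar> \<le> 1 \<and> (u, v) \<noteq> (0, 0)"
proof -
  have small: "\<bar>w\<bar> \<le> 1 \<longleftrightarrow> w = -1 \<or> w = 0 \<or> w = 1" for w :: int by auto
  show ?thesis unfolding directions8_def small by auto
qed

lemma play_sound:
  "play S P ms = Some Q \<Longrightarrow> (jump8 (Collect S))\<^sup>*\<^sup>* (set P) (set Q)"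
proof (induction S P ms rule: play.induct)
  case (2 S P x y u v ms)
  let ?P' = "(x + 2 * u, y + 2 * v) # filter (\<lambda>h. h \<noteq> (x, y) \<and> h \<noteq> (x + u, y + v)) P"
  from 2(2) have "S (x, y) \<and> S (x + u, y + v) \<and> S (x + 2 * u, y + 2 * v) \<and>
      (u, v) \<in> directions8 \<and> (x, y) \<in> set P \<and> (x + u, y + v) \<in> set P \<and>
      (x + 2 * u, y + 2 * v) \<notin> set P \<and> play S ?P' ms = Some Q"
    unfolding play.simps Let_def directions8_iff
    by (simp only: option.distinct split: if_splits) simp
  then have legal: "S (x, y)" "S (x + u, y + v)" "S (x + 2 * u, y + 2 * v)"
      "(u, v) \<in> directions8"
      "(x, y) \<in> set P" "(x + u, y + v) \<in> set P" "(x + 2 * u, y + 2 * v) \<notin> set P"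
    and rest: "play S ?P' ms = Some Q"
    by blast+
  have set: "set ?P' = insert (x + 2 * u, y + 2 * v) (set P - {(x, y), (x + u, y + v)})"
    by auto
  have "jump8 (Collect S) (set P) (set ?P')"
    unfolding set by (rule jump8.intros) (use legal in auto)
  moreover have "(jump8 (Collect S))\<^sup>*\<^sup>* (set ?P') (set Q)"
    \<comment> \<open>The three \<open>refl\<close> settle the equations for the
      \<open>let\<close>-bound holes \<open>p\<close>, \<open>q\<close> and \<open>r\<close>; the
      open premise is the legality test.\<close>
    using 2(1)[OF refl refl refl _ rest] legal by (simp add: directions8_iff)
  ultimately show ?case by (rule converse_rtranclp_into_rtranclp)
qed simp

lemma leads_to_sound:
  assumes "leads_to S P ms Q"
  shows "(jump8 (Collect S))\<^sup>*\<^sup>* (set P) (set Q)"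
proof -
  from assms obtain P' where "play S P ms = Some P'" and "set P' = set Q"
    by (auto simp: leads_to_def split: option.splits)
  then show ?thesis using play_sound by metis
qed

lemma set_holes:
  assumes "\<And>x y. S (x, y) \<Longrightarrow> \<bar>x\<bar> \<le> 4 \<and> \<bar>y\<bar> \<le> 4"
  shows "set (holes S) = Collect S"
proof -
  have "b \<in> {-4..4} \<times> {-4..4}" if "S b" for b
    using assms[of "fst b" "snd b"] that by (auto simp: mem_Times_iff)
  then show ?thesis
    unfolding holes_def set_filter set_product set_upto by blast
qed

text \<open>\<open>list_all2\<close> pairs the holes satisfying \<open>F\<close> with the recorded
  sequences and forces equal lengths, so no such hole is left without a solution.\<close>

lemma ends_sound:
  assumes "\<And>x y. S (x, y) \<Longrightarrow> \<bar>x\<bar> \<le> 4 \<and> \<bar>y\<bar> \<le> 4"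
    and "list_all2 (\<lambda>b ms. leads_to S R ms [b]) (filter F (holes S)) ends"
    and "S b" and "F b"
  shows "(jump8 (Collect S))\<^sup>*\<^sup>* (set R) {b}"
proof -
  have "b \<in> set (filter F (holes S))" using assms set_holes[OF assms(1)] by simp
  then obtain ms where "leads_to S R ms [b]"
    using assms(2) by (metis in_set_conv_nth list_all2_conv_all_nth)
  from leads_to_sound[OF this] show ?thesis by simp
qed

lemma bridge_sound:
  assumes "\<And>x y. S (x, y) \<Longrightarrow> \<bar>x\<bar> \<le> 4 \<and> \<bar>y\<bar> \<le> 4"
    and "leads_to S (filter (\<lambda>h. h \<notin> set R) (holes S)) ms Q"
  shows "(jump8 (Collect S))\<^sup>*\<^sup>* (Collect S - set R) (set Q)"
proof -
  have "set (filter (\<lambda>h. h \<notin> set R) (holes S)) = Collect S - set R"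
    using set_holes[OF assms(1)] by auto
  with leads_to_sound[OF assms(2)] show ?thesis by simp
qed

section \<open>The four boards, centered at the origin\<close>

text \<open>Every \<open>b\<close> is the image of \<open>f b\<close>, so for an involution
  invariance in one direction already gives equality.\<close>

lemma involution_image_Collect:
  assumes "\<And>b. f (f b) = b" and "\<And>b. S b \<Longrightarrow> S (f b)"
  shows "f ` Collect S = Collect S"
proof (intro set_eqI iffI)
  fix b assume "b \<in> Collect S"
  then show "b \<in> f ` Collect S" using assms by (intro image_eqI[of _ _ "f b"]) auto
qed (use assms in auto)

text \<open>With the center at the origin, the symmetries of the boards become swaps and sign
  changes of coordinates.\<close>

definition diamond4 :: "hole \<Rightarrow> bool" where
  "diamond4 = (\<lambda>(x, y). \<bar>x\<bar> + \<bar>y\<bar> \<le> 3)"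

definition cross33 :: "hole \<Rightarrow> bool" where
  "cross33 = (\<lambda>(x, y). \<bar>x\<bar> \<le> 3 \<and> \<bar>y\<bar> \<le> 3 \<and> (\<bar>x\<bar> \<le> 1 \<or> \<bar>y\<bar> \<le> 1))"

definition octagon37 :: "hole \<Rightarrow> bool" where
  "octagon37 = (\<lambda>(x, y). \<bar>x\<bar> \<le> 3 \<and> \<bar>y\<bar> \<le> 3 \<and> \<bar>x\<bar> + \<bar>y\<bar> \<le> 4)"

definition diamond5 :: "hole \<Rightarrow> bool" where
  "diamond5 = (\<lambda>(x, y). \<bar>x\<bar> + \<bar>y\<bar> \<le> 4)"

section \<open>Explicit positions and jump sequences\<close>

text \<open>
  A jump is recorded as its starting hole and its direction. The sequences in \<open>diamond4_ends\<close> and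
  \<open>cross33_ends\<close> end at the holes with \<^prop>\<open>x \<le> y\<close>, those in \<open>block_ends\<close> at the holes with
  \<^prop>\<open>0 \<le> x \<and> x \<le> y\<close>, in lexicographic order. The fifth sequence of \<open>block_ends\<close> ends at \<open>(0, 4)\<close> and is
  therefore dropped on the 37-hole board.
\<close>

definition diamond4_mid :: "hole list" where
  "diamond4_mid =
    [(-3, 0), (-2, -1), (-2, 0), (-1, -2), (-1, -1), (-1, 0), (0, -3), (0, -2), (0, -1)]"

definition diamond4_bridge :: "(hole \<times> hole) list" where
  "diamond4_bridge =
    [((-1, 2), (0, -1)), ((-2, 1), (1, -1)), ((1, 0), (-1, -1)), ((1, -2), (0, 1)),
     ((0, 1), (0, -1)), ((2, -1), (-1, 1)), ((-1, -2), (1, 1))]"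

definition diamond4_ends :: "(hole \<times> hole) list list" where
  "diamond4_ends =
    [[((-2, -1), (0, 1)), ((-3, 0), (1, 1)), ((-1, -2), (1, 0)), ((-1, -1), (1, 0)),
      ((0, -3), (1, 1)), ((2, -1), (-1, 0)), ((0, -1), (-1, 1)), ((-1, 2), (-1, -1))],
     [((-2, -1), (0, 1)), ((-1, -2), (1, 0)), ((-1, -1), (0, 1)), ((-2, 1), (1, 0)),
      ((1, -2), (-1, 1)), ((0, 1), (-1, -1)), ((-3, 0), (1, -1)), ((0, -3), (-1, 1))],
     [((-2, 0), (1, 0)), ((-1, -2), (1, 1)), ((-3, 0), (1, -1)), ((0, -3), (-1, 1)),
      ((-2, -1), (1, 0)), ((1, 0), (-1, 0)), ((0, -2), (0, 1)), ((0, 0), (-1, 0))],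
     [((-2, -1), (0, 1)), ((-3, 0), (1, 1)), ((-1, -1), (0, 1)), ((-1, 2), (0, -1)),
      ((0, -3), (-1, 1)), ((0, -2), (0, 1)), ((0, 0), (-1, 0)), ((-2, -1), (0, 1))],
     [((-2, -1), (1, 1)), ((-3, 0), (1, 0)), ((-1, -2), (1, 1)), ((-1, -1), (0, 1)),
      ((-1, 1), (1, 0)), ((0, -3), (0, 1)), ((1, 1), (0, -1)), ((1, -1), (-1, 0))],
     [((-2, -1), (0, 1)), ((-3, 0), (1, 1)), ((0, -3), (-1, 1)), ((-2, -1), (1, 1)),
      ((0, -2), (0, 1)), ((-1, -1), (1, 1)), ((1, 1), (-1, 0)), ((-1, 2), (0, -1))],
     [((-2, -1), (0, 1)), ((-3, 0), (1, 1)), ((0, -3), (-1, 1)), ((-2, -1), (1, 1)),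
      ((-1, 2), (1, -1)), ((0, -2), (0, 1)), ((1, 0), (-1, 0)), ((-1, -1), (0, 1))],
     [((-2, -1), (0, 1)), ((-3, 0), (1, 1)), ((0, -3), (-1, 1)), ((0, -2), (-1, 1)),
      ((-2, -1), (0, 1)), ((-1, 2), (-1, -1)), ((0, -1), (-1, 1)), ((-3, 0), (1, 1))],
     [((-2, -1), (0, 1)), ((-3, 0), (1, 1)), ((-1, -1), (1, 0)), ((0, -3), (-1, 1)),
      ((-2, -1), (1, 1)), ((-1, 2), (1, -1)), ((0, -2), (1, 1)), ((2, 0), (-1, 0))],
     [((-2, -1), (0, 1)), ((-3, 0), (1, 1)), ((-1, -2), (1, 0)), ((0, -3), (1, 1)),
      ((0, -1), (-1, 0)), ((-2, -1), (1, 1)), ((-1, 2), (1, -1)), ((2, -1), (-1, 1))],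
     [((-2, -1), (0, 1)), ((-3, 0), (1, 1)), ((-1, -1), (0, 1)), ((-1, 2), (0, -1)),
      ((0, -3), (-1, 1)), ((-2, -1), (1, 1)), ((0, -2), (0, 1)), ((0, 0), (0, 1))],
     [((-2, -1), (0, 1)), ((-3, 0), (1, 1)), ((-1, -2), (1, 0)), ((-1, -1), (1, 0)),
      ((0, -3), (1, 1)), ((2, -1), (-1, 0)), ((0, -1), (-1, 1)), ((-2, 1), (1, 1))],
     [((-2, -1), (1, 1)), ((-3, 0), (1, 0)), ((0, -3), (-1, 1)), ((0, -2), (0, 1)),
      ((-1, -1), (1, 1)), ((1, 1), (-1, 0)), ((-2, -1), (1, 1)), ((-1, 1), (1, 0))],
     [((-2, -1), (0, 1)), ((-3, 0), (1, 1)), ((0, -3), (-1, 1)), ((-2, -1), (1, 1)),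
      ((-1, 2), (1, -1)), ((0, -2), (0, 1)), ((-1, -1), (1, 1)), ((1, 0), (0, 1))]]"

definition cross33_mid :: "hole list" where
  "cross33_mid =
    [(-3, -1), (-2, -1), (-2, 0), (-1, -3), (-1, -2), (0, -2), (0, 1), (1, 0), (1, 1)]"

definition cross33_bridge :: "(hole \<times> hole) list" where
  "cross33_bridge =
    [((1, 3), (0, -1)), ((3, 0), (-1, 1)), ((2, 0), (-1, -1)), ((3, -1), (-1, 0)),
     ((1, -3), (-1, 0)), ((0, 3), (1, -1)), ((-3, 1), (0, -1)), ((-2, 1), (1, 0)),
     ((-1, 3), (0, -1)), ((0, -1), (-1, 0)), ((0, 2), (-1, -1)), ((1, -2), (0, 1)),
     ((1, 1), (-1, -1)), ((-1, 0), (0, -1)), ((3, 1), (-1, 0))]"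

definition cross33_ends :: "(hole \<times> hole) list list" where
  "cross33_ends =
    [[((-3, -1), (1, 0)), ((-1, -3), (1, 1)), ((-1, -2), (0, 1)), ((0, 1), (1, 0)),
      ((2, 1), (-1, -1)), ((1, -1), (-1, 0)), ((-1, -1), (0, 1)), ((-1, 1), (-1, -1))],
     [((-3, -1), (1, 1)), ((-1, -3), (0, 1)), ((0, -2), (-1, 1)), ((-2, -1), (0, 1)),
      ((1, 0), (0, 1)), ((1, 2), (-1, -1)), ((-1, 0), (0, 1)), ((-1, 2), (-1, -1))],
     [((-3, -1), (1, 0)), ((-1, -2), (1, 0)), ((0, 1), (1, 0)), ((2, 1), (-1, -1)),
      ((1, -2), (-1, 1)), ((-1, 0), (0, -1)), ((-1, -3), (0, 1)), ((-1, -1), (-1, 1))],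
     [((-3, -1), (1, 0)), ((-1, -3), (1, 1)), ((-2, 0), (1, -1)), ((0, -2), (1, 1)),
      ((2, 0), (-1, 0)), ((1, 1), (-1, -1)), ((-1, -2), (0, 1)), ((0, 1), (-1, -1))],
     [((-2, -1), (0, 1)), ((-1, -3), (0, 1)), ((1, 0), (0, 1)), ((1, 2), (-1, -1)),
      ((-2, 1), (1, -1)), ((0, -1), (-1, 0)), ((-3, -1), (1, 0)), ((0, -2), (-1, 1))],
     [((-3, -1), (1, 0)), ((-1, -3), (1, 1)), ((-1, -2), (0, 1)), ((0, 1), (1, 0)),
      ((1, -1), (0, 1)), ((2, 1), (-1, 0)), ((0, 1), (-1, -1)), ((-2, -1), (0, 1))],
     [((-3, -1), (1, 0)), ((-1, -3), (1, 1)), ((-1, -2), (0, 1)), ((-2, 0), (1, 0)),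
      ((1, -1), (-1, 1)), ((1, 0), (0, 1)), ((1, 2), (-1, -1)), ((-1, 1), (0, -1))],
     [((-3, -1), (1, 0)), ((-1, -3), (1, 1)), ((-2, 0), (1, -1)), ((0, 1), (1, -1)),
      ((2, -1), (-1, 0)), ((0, -2), (0, 1)), ((1, 1), (-1, -1)), ((-1, -2), (0, 1))],
     [((-3, -1), (1, 0)), ((-1, -3), (1, 1)), ((-2, 0), (1, -1)), ((-1, -2), (1, 0)),
      ((0, 1), (1, -1)), ((1, -2), (0, 1)), ((2, -1), (-1, 1)), ((1, 1), (-1, 0))],
     [((-3, -1), (1, 0)), ((-1, -3), (1, 1)), ((-1, -2), (0, 1)), ((-2, 0), (1, 0)),
      ((1, -1), (-1, 1)), ((1, 0), (0, 1)), ((1, 2), (-1, -1)), ((-1, 0), (0, 1))],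
     [((-3, -1), (1, 1)), ((-1, -3), (0, 1)), ((-2, -1), (1, 0)), ((0, -2), (0, 1)),
      ((0, 0), (1, 0)), ((2, 0), (-1, 1)), ((-1, 1), (1, 0)), ((1, 1), (-1, 1))],
     [((-3, -1), (1, 0)), ((-1, -3), (1, 1)), ((-2, 0), (1, -1)), ((0, -2), (1, 1)),
      ((0, 1), (1, 0)), ((2, 1), (-1, -1)), ((-1, -2), (1, 1)), ((2, 0), (-1, 0))],
     [((-3, -1), (1, 1)), ((-1, -3), (0, 1)), ((-2, -1), (1, 0)), ((0, -2), (0, 1)),
      ((-1, 1), (1, -1)), ((0, 1), (1, 0)), ((1, -1), (0, 1)), ((2, 1), (-1, 0))],
     [((-3, -1), (1, 0)), ((-1, -3), (1, 1)), ((-1, -2), (0, 1)), ((-2, 0), (1, 0)),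
      ((0, 0), (0, 1)), ((0, 2), (1, -1)), ((1, -1), (0, 1)), ((2, 0), (-1, 1))],
     [((-3, -1), (1, 1)), ((-1, -3), (0, 1)), ((-2, -1), (1, 0)), ((1, 1), (0, -1)),
      ((1, -1), (-1, 0)), ((0, -2), (-1, 1)), ((-2, 0), (1, 1)), ((0, 1), (0, 1))],
     [((-3, -1), (1, 0)), ((-1, -3), (1, 1)), ((-1, -2), (0, 1)), ((-2, 0), (1, 0)),
      ((0, 0), (1, 0)), ((0, 1), (1, 0)), ((1, -1), (1, 1)), ((3, 1), (-1, 0))],
     [((-3, -1), (1, 0)), ((-1, -3), (1, 1)), ((-2, 0), (1, -1)), ((0, -2), (1, 1)),
      ((2, 0), (-1, 0)), ((0, 1), (0, -1)), ((-1, -2), (1, 1)), ((1, 0), (0, 1))],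
     [((-3, -1), (1, 0)), ((-1, -3), (1, 1)), ((-1, -2), (0, 1)), ((-2, 0), (1, 0)),
      ((1, -1), (-1, 1)), ((1, 0), (0, 1)), ((-1, 1), (1, 0)), ((1, 1), (0, 1))]]"

definition block :: "hole list" where
  "block =
    List.product [-1..1] [-1..1]"

definition octagon37_bridge :: "(hole \<times> hole) list" where
  "octagon37_bridge =
    [((-1, -3), (0, 1)), ((0, -3), (0, 1)), ((1, -3), (0, 1)), ((3, -1), (-1, 1)),
     ((0, 2), (1, -1)), ((3, 1), (-1, 0)), ((-3, 0), (1, 0)), ((-3, 1), (1, 0)),
     ((1, 3), (1, -1)), ((2, 0), (-1, 1)), ((-2, -2), (1, 1)), ((0, 3), (0, -1)),
     ((-2, 2), (1, 0)), ((2, -2), (0, 1)), ((3, 1), (0, -1)), ((3, -1), (-1, 1)),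
     ((1, 2), (0, -1)), ((-1, 3), (1, -1)), ((-3, -1), (1, 0))]"

definition diamond5_bridge :: "(hole \<times> hole) list" where
  "diamond5_bridge =
    [((3, -1), (-1, 1)), ((1, 3), (-1, -1)), ((-1, -3), (1, 1)), ((0, -4), (0, 1)),
     ((-1, 2), (0, -1)), ((-3, 1), (1, -1)), ((-2, -2), (0, 1)), ((0, 4), (0, -1)),
     ((-3, -1), (1, 1)), ((2, -2), (-1, 1)), ((-4, 0), (1, 0)), ((4, 0), (-1, 0)),
     ((3, 1), (-1, 1)), ((1, 2), (1, -1)), ((3, 0), (-1, 0)), ((-1, -1), (0, -1)),
     ((-1, -3), (1, 1)), ((-2, 1), (1, 0)), ((-1, 3), (-1, -1)), ((-3, 1), (1, -1)),
     ((1, 3), (-1, -1)), ((2, -1), (-1, 0)), ((1, -3), (0, 1))]"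

definition block_ends :: "(hole \<times> hole) list list" where
  "block_ends =
    [[((-1, 0), (1, 1)), ((0, 0), (1, 0)), ((1, 2), (0, -1)), ((1, -1), (0, 1)),
      ((2, 0), (-1, 1)), ((0, 2), (-1, -1)), ((-2, 0), (1, -1)), ((0, -2), (0, 1))],
     [((-1, 0), (0, 1)), ((0, -1), (1, 0)), ((0, 1), (0, -1)), ((0, -1), (-1, 0)),
      ((2, -1), (-1, 1)), ((1, 1), (-1, 0)), ((-1, 2), (0, -1)), ((-2, -1), (1, 1))],
     [((-1, 0), (0, 1)), ((0, 0), (1, 0)), ((1, 1), (-1, 0)), ((-1, 2), (0, -1)),
      ((-1, 0), (0, -1)), ((-1, -2), (1, 1)), ((1, -1), (0, 1)), ((2, 0), (-1, 1))],
     [((-1, 0), (0, 1)), ((0, -1), (1, 0)), ((0, 1), (1, 0)), ((-1, -1), (1, 1)),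
      ((2, -1), (-1, 1)), ((-1, 2), (1, -1)), ((1, 0), (0, 1)), ((2, 1), (-1, 1))],
     [((-1, 0), (0, 1)), ((1, 0), (0, -1)), ((1, -2), (-1, 1)), ((-1, -1), (0, 1)),
      ((-1, 1), (0, 1)), ((1, 1), (-1, 0)), ((0, 0), (-1, 1)), ((-2, 2), (1, 1))],
     [((-1, 0), (0, 1)), ((0, -1), (1, 0)), ((0, 0), (1, 0)), ((-1, 2), (1, -1)),
      ((1, 1), (0, -1)), ((2, 0), (0, -1)), ((2, -2), (-1, 1)), ((-1, -1), (1, 1))],
     [((-1, 0), (0, 1)), ((0, -1), (1, 0)), ((1, 1), (0, -1)), ((2, -1), (-1, 0)),
      ((-1, -1), (1, 0)), ((1, -1), (-1, 1)), ((-1, 2), (0, -1)), ((-1, 0), (1, 1))],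
     [((-1, 0), (0, 1)), ((0, -1), (1, 0)), ((0, 0), (0, 1)), ((2, -1), (-1, 1)),
      ((1, 1), (-1, 0)), ((-1, 2), (0, -1)), ((-1, -1), (0, 1)), ((-1, 1), (1, 1))],
     [((-1, 0), (0, 1)), ((0, -1), (1, 0)), ((1, 1), (-1, 0)), ((-1, 2), (0, -1)),
      ((-1, -1), (0, 1)), ((2, -1), (-1, 1)), ((-1, 1), (1, 0)), ((0, 0), (1, 1))]]"

section \<open>Verification of the sequences by evaluation\<close>

lemma diamond4_check:
  "list_all2 (\<lambda>b ms. leads_to diamond4 diamond4_mid ms [b])
    (filter (\<lambda>(x, y). x \<le> y) (holes diamond4)) diamond4_ends"
  "leads_to diamond4 (filter (\<lambda>h. h \<notin> set diamond4_mid) (holes diamond4))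
    diamond4_bridge (map (\<lambda>(x, y). (- x, - y)) diamond4_mid)"
  by code_simp+

lemma cross33_check:
  "list_all2 (\<lambda>b ms. leads_to cross33 cross33_mid ms [b])
    (filter (\<lambda>(x, y). x \<le> y) (holes cross33)) cross33_ends"
  "leads_to cross33 (filter (\<lambda>h. h \<notin> set cross33_mid) (holes cross33))
    cross33_bridge cross33_mid"
  by code_simp+

text \<open>\<open>octagon37\<close> is \<open>diamond5\<close> without its four tips, so every
  sequence legal here is legal on \<open>diamond5\<close> too. In the octant only the tip
  \<open>(0, 4)\<close> needs a solution of its own.\<close>

lemma octagon37_check:
  "list_all2 (\<lambda>b ms. leads_to octagon37 block ms [b])
    (filter (\<lambda>(x, y). 0 \<le> x \<and> x \<le> y) (holes octagon37)) (take 4 block_ends @ drop 5 block_ends)"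
  "leads_to octagon37 (filter (\<lambda>h. h \<notin> set block) (holes octagon37)) octagon37_bridge block"
  by code_simp+

lemma diamond5_check:
  "list_all2 (\<lambda>b ms. leads_to diamond5 block ms [b])
    (filter (\<lambda>(x, y). 0 \<le> x \<and> x \<le> y) (holes diamond5)) block_ends"
  "leads_to diamond5 (filter (\<lambda>h. h \<notin> set block) (holes diamond5)) diamond5_bridge block"
  by code_simp+

section \<open>Solvability of the centered boards\<close>

lemma solvable_diamond4: "solvable (Collect diamond4)"
proof (rule solvable_if_universal)
  have bounds: "\<bar>x\<bar> \<le> 4 \<and> \<bar>y\<bar> \<le> 4" if "diamond4 (x, y)" for x y
    using that by (auto simp: diamond4_def)
  have "prod.swap ` Collect diamond4 = Collect diamond4"
    by (rule involution_image_Collect) (auto simp: diamond4_def)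
  moreover have "prod.swap ` set diamond4_mid = set diamond4_mid"
    by (auto simp: diamond4_mid_def)
  moreover have "(jump8 (Collect diamond4))\<^sup>*\<^sup>* (set diamond4_mid) {(x, y)}"
    if "(x, y) \<in> Collect diamond4" "x \<le> y" for x y
    using ends_sound[OF bounds diamond4_check(1), of "(x, y)"] that by simp
  ultimately show universal: "universal (Collect diamond4) (set diamond4_mid)"
    by (rule universal_by_diagonal_symmetry)
  show "set diamond4_mid \<subseteq> Collect diamond4"
    by (simp add: diamond4_mid_def diamond4_def)
  show "(jump8 (Collect diamond4))\<^sup>*\<^sup>* (Collect diamond4 - set diamond4_mid)
      (set (map (\<lambda>(x, y). (- x, - y)) diamond4_mid))"
    by (rule bridge_sound[OF bounds diamond4_check(2)])
  \<comment> \<open>The half turn preserves the board, so it carries the universality of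
    \<open>diamond4_mid\<close> over to the position where the bridge ends.\<close>
  have "(\<lambda>(x, y). (- x, - y)) ` Collect diamond4 = Collect diamond4"
    by (rule involution_image_Collect) (auto simp: diamond4_def)
  then show "universal (Collect diamond4) (set (map (\<lambda>(x, y). (- x, - y)) diamond4_mid))"
    using universal_image[OF lattice_symmetry_rotate universal] by simp
qed

lemma solvable_cross33: "solvable (Collect cross33)"
proof (rule solvable_if_universal)
  have bounds: "\<bar>x\<bar> \<le> 4 \<and> \<bar>y\<bar> \<le> 4" if "cross33 (x, y)" for x y
    using that by (auto simp: cross33_def)
  have "prod.swap ` Collect cross33 = Collect cross33"
    by (rule involution_image_Collect) (auto simp: cross33_def)
  moreover have "prod.swap ` set cross33_mid = set cross33_mid"
    by (auto simp: cross33_mid_def)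
  moreover have "(jump8 (Collect cross33))\<^sup>*\<^sup>* (set cross33_mid) {(x, y)}"
    if "(x, y) \<in> Collect cross33" "x \<le> y" for x y
    using ends_sound[OF bounds cross33_check(1), of "(x, y)"] that by simp
  ultimately show universal: "universal (Collect cross33) (set cross33_mid)"
    by (rule universal_by_diagonal_symmetry)
  show "universal (Collect cross33) (set cross33_mid)" by (rule universal)
  show "set cross33_mid \<subseteq> Collect cross33"
    by (simp add: cross33_mid_def cross33_def)
  show "(jump8 (Collect cross33))\<^sup>*\<^sup>* (Collect cross33 - set cross33_mid) (set cross33_mid)"
    by (rule bridge_sound[OF bounds cross33_check(2)])
qed

lemma block_symmetric:
  "prod.swap ` set block = set block" "(\<lambda>(x, y). (- x, y)) ` set block = set block"
  by code_simp+

lemma solvable_octagon37: "solvable (Collect octagon37)"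
proof (rule solvable_if_universal)
  have bounds: "\<bar>x\<bar> \<le> 4 \<and> \<bar>y\<bar> \<le> 4" if "octagon37 (x, y)" for x y
    using that by (auto simp: octagon37_def)
  have "prod.swap ` Collect octagon37 = Collect octagon37"
    "(\<lambda>(x, y). (- x, y)) ` Collect octagon37 = Collect octagon37"
    by (rule involution_image_Collect; auto simp: octagon37_def)+
  moreover have "(jump8 (Collect octagon37))\<^sup>*\<^sup>* (set block) {(x, y)}"
    if "(x, y) \<in> Collect octagon37" "0 \<le> x" "x \<le> y" for x y
    using ends_sound[OF bounds octagon37_check(1), of "(x, y)"] that by simp
  ultimately show universal: "universal (Collect octagon37) (set block)"
    using block_symmetric by (intro universal_by_full_symmetry)
  show "universal (Collect octagon37) (set block)" by (rule universal)
  show "set block \<subseteq> Collect octagon37"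
    by (auto simp: block_def octagon37_def)
  show "(jump8 (Collect octagon37))\<^sup>*\<^sup>* (Collect octagon37 - set block) (set block)"
    by (rule bridge_sound[OF bounds octagon37_check(2)])
qed

lemma solvable_diamond5: "solvable (Collect diamond5)"
proof (rule solvable_if_universal)
  have bounds: "\<bar>x\<bar> \<le> 4 \<and> \<bar>y\<bar> \<le> 4" if "diamond5 (x, y)" for x y
    using that by (auto simp: diamond5_def)
  have "prod.swap ` Collect diamond5 = Collect diamond5"
    "(\<lambda>(x, y). (- x, y)) ` Collect diamond5 = Collect diamond5"
    by (rule involution_image_Collect; auto simp: diamond5_def)+
  moreover have "(jump8 (Collect diamond5))\<^sup>*\<^sup>* (set block) {(x, y)}"
    if "(x, y) \<in> Collect diamond5" "0 \<le> x" "x \<le> y" for x y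
    using ends_sound[OF bounds diamond5_check(1), of "(x, y)"] that by simp
  ultimately show universal: "universal (Collect diamond5) (set block)"
    using block_symmetric by (intro universal_by_full_symmetry)
  show "universal (Collect diamond5) (set block)" by (rule universal)
  show "set block \<subseteq> Collect diamond5"
    by (auto simp: block_def diamond5_def)
  show "(jump8 (Collect diamond5))\<^sup>*\<^sup>* (Collect diamond5 - set block) (set block)"
    by (rule bridge_sound[OF bounds diamond5_check(2)])
qed

section \<open>Return to the original coordinates\<close>

lemma translate_Collect:
  "(\<lambda>(x, y). (x + c, y + d)) ` Collect S = {(x, y). S (x - c, y - d)}" for c d :: int
proof (intro set_eqI iffI)
  fix h assume "h \<in> {(x, y). S (x - c, y - d)}"
  then show "h \<in> (\<lambda>(x, y). (x + c, y + d)) ` Collect S"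
    by (intro image_eqI[of _ _ "(fst h - c, snd h - d)"]) auto
qed auto

text \<open>\<open>Diamond n\<close> has its center at \<open>(n, n)\<close>, hence the shift by 5
  in the last case. The 7 by 7 boards have theirs at \<open>(4, 4)\<close>, where
  \<open>3 \<le> x \<le> 5\<close> becomes an absolute value of at most 1.\<close>

lemma boards_are_translates:
  "board33 = (\<lambda>(x, y). (x + 4, y + 4)) ` Collect cross33"
  "board37 = (\<lambda>(x, y). (x + 4, y + 4)) ` Collect octagon37"
  "Diamond 4 = (\<lambda>(x, y). (x + 4, y + 4)) ` Collect diamond4"
  "Diamond 5 = (\<lambda>(x, y). (x + 5, y + 5)) ` Collect diamond5"
  unfolding translate_Collect
     apply (auto simp: board33_def cross33_def abs_le_iff)[1]
    apply (auto simp: board37_def octagon37_def abs_le_iff)[1]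
   apply (simp add: Diamond_def diamond4_def)
  apply (simp add: Diamond_def diamond5_def)
  done

theorem theorem1:
  fixes B :: "hole set" and a b :: hole
  assumes "B \<in> {board33, board37, Diamond 4, Diamond 5}"
    and "a \<in> B" and "b \<in> B"
  shows "(jump8 B)\<^sup>*\<^sup>* (B - {a}) {b}"
proof -
  have "solvable board33" "solvable board37" "solvable (Diamond 4)" "solvable (Diamond 5)"
    unfolding boards_are_translates
    by (intro solvable_image lattice_symmetry_translate solvable_cross33 solvable_octagon37
        solvable_diamond4 solvable_diamond5)+
  then have "solvable B" using assms(1) by auto
  then show ?thesis using assms(2,3) by (simp add: solvable_def)
qed

end
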